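(* Let $\mathcal{H}$ be a complex Hilbert space, let $A\in\mathbb{B}(\mathcal{H})$ be a positive operator, and let $T, S\in\mathbb{B}_{A^{1/2}}(\mathcal{H})$. Then the following conditions are equivalent: (i) $A^{1/2}T = \lambda A^{1/2}S$ for some $\lambda \in \mathbb{T}$. (ii) $w_{A}(TR) = w_{A}(SR)$ for all $R\in\mathbb{B}_{A^{1/2}}(\mathcal{H})$. (iii) $w_{A}\big(Tx \otimes_{A} y\big) = w_{A}\big(Sx \otimes_{A} y\big)$ for all $x, y \in\mathcal{H}\setminus\{0\}$.
   Context: $\mathbb{B}(\mathcal{H})$ denotes the bounded linear operators on the complex Hilbert space $(\mathcal{H},\langle\cdot,\cdot\rangle)$. $A\in\mathbb{B}(\mathcal{H})$ is positive, meaning $\langle Ax,x\rangle\ge 0$ for all $x\in\mathcal{H}$ ($A$ need not be injective or have closed range), and $A^{1/2}$ is its positive square root. Put $\langle x,y\rangle_A := \langle Ax,y\rangle$ and $\|x\|_A := \langle x,x\rangle_A^{1/2}$. $\mathbb{B}_{A^{1/2}}(\mathcal{H})$ is the set of all $T\in\mathbb{B}(\mathcal{H})$ admitting an $A^{1/2}$-adjoint, i.e. for which there is $R\in\mathbb{B}(\mathcal{H})$ with $A^{1/2}R=T^*A^{1/2}$; equivalently, those $T\in\mathbb{B}(\mathcal{H})$ for which there is $c>0$ with $\|Tx\|_A\le c\|x\|_A$ for all $x\in\mathcal{H}$. The $A$-numerical radius of $T\in\mathbb{B}(\mathcal{H})$ is $w_A(T) := \sup\{|\langle Tx,x\rangle_A|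 : x\in\mathcal{H},\ \|x\|_A=1\}$. For $x,y\in\mathcal{H}$, the $A$-rank one operator $x\otimes_A y\in\mathbb{B}(\mathcal{H})$ is defined by $(x\otimes_A y)z := \langle z,y\rangle_A\, x$ for $z\in\mathcal{H}$; $Tx\otimes_A y$ means $(Tx)\otimes_A y$. $\mathbb{T}=\{\alpha\in\mathbb{C}: |\alpha|=1\}$ is the unit circle. *)

theory Defs
  imports "HOL-Analysis.Analysis"
begin

text \<open>A type of this class is a complex Hilbert space (of arbitrary dimension, possibly
  trivial). The inner product is linear in its \<^emph>\<open>first\<close> argument. The real vector space
  structure, the norm and the metric are those of the superclasses; the axioms
  \<open>scaleC_of_real\<close> and \<open>cinner_self\<close> tie them to \<open>scaleC\<close> and \<open>cinner\<close>, the latter also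
  yielding positive definiteness.\<close>

class complex_hilbert = real_normed_vector + complete_space +
  fixes scaleC :: "complex \<Rightarrow> 'a \<Rightarrow> 'a" (infixr \<open>*\<^sub>C\<close> 75)
    and cinner :: "'a \<Rightarrow> 'a \<Rightarrow> complex"
  assumes scaleC_add_right: "a *\<^sub>C (x + y) = a *\<^sub>C x + a *\<^sub>C y"
    and scaleC_add_left: "(a + b) *\<^sub>C x = a *\<^sub>C x + b *\<^sub>C x"
    and scaleC_scaleC: "a *\<^sub>C b *\<^sub>C x = (a * b) *\<^sub>C x"
    and scaleC_of_real: "complex_of_real r *\<^sub>C x = r *\<^sub>R x"
    and cinner_commute: "cinner x y = cnj (cinner y x)"
    and cinner_add_left: "cinner (x + y) z = cinner x z + cinner y z"
    and cinner_scaleC_left: "cinner (a *\<^sub>C x) y = a * cinner x y"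
    and cinner_self: "cinner x x = complex_of_real ((norm x)\<^sup>2)"

instantiation complex :: complex_hilbert
begin

definition scaleC_complex :: "complex \<Rightarrow> complex \<Rightarrow> complex"
  where "scaleC_complex = (*)"

definition cinner_complex :: "complex \<Rightarrow> complex \<Rightarrow> complex"
  where "cinner_complex x y = x * cnj y"

instance
  by standard
    (simp_all add: scaleC_complex_def cinner_complex_def algebra_simps scaleR_conv_of_real
      complex_norm_square[symmetric])

end

definition bounded_ops :: "('a::complex_hilbert \<Rightarrow> 'a) set"
  where "bounded_ops = {T. bounded_linear T \<and> (\<forall>c x. T (c *\<^sub>C x) = c *\<^sub>C T x)}"

definition positive_op :: "('a::complex_hilbert \<Rightarrow> 'a) \<Rightarrow> bool"
  where "positive_op A \<longleftrightarrow> A \<in> bounded_ops \<and> (\<forall>x. cinner (A x) x \<in> \<real>\<^sub>\<ge>\<^sub>0)"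

definition adjoint_op :: "('a::complex_hilbert \<Rightarrow> 'a) \<Rightarrow> 'a \<Rightarrow> 'a"
  where "adjoint_op T =
    (THE R. R \<in> bounded_ops \<and> (\<forall>x y. cinner (T x) y = cinner x (R y)))"

definition sqrt_op :: "('a::complex_hilbert \<Rightarrow> 'a) \<Rightarrow> 'a \<Rightarrow> 'a"
  where "sqrt_op A = (THE B. positive_op B \<and> B \<circ> B = A)"

definition cinner_wrt :: "('a::complex_hilbert \<Rightarrow> 'a) \<Rightarrow> 'a \<Rightarrow> 'a \<Rightarrow> complex"
  where "cinner_wrt A x y = cinner (A x) y"

definition norm_wrt :: "('a::complex_hilbert \<Rightarrow> 'a) \<Rightarrow> 'a \<Rightarrow> real"
  where "norm_wrt A x = sqrt (Re (cinner_wrt A x x))"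

definition sqrt_adjointable_ops :: "('a::complex_hilbert \<Rightarrow> 'a) \<Rightarrow> ('a \<Rightarrow> 'a) set"
  where "sqrt_adjointable_ops A =
    {T \<in> bounded_ops. \<exists>R\<in>bounded_ops. sqrt_op A \<circ> R = adjoint_op T \<circ> sqrt_op A}"

text \<open>The supremum is taken in \<open>[0, \<infinity>]\<close>: it may be infinite for a bounded operator that is
  not bounded with respect to \<open>norm_wrt A\<close>, and it is \<open>0\<close> over the empty set (which occurs,
  for positive \<open>A\<close>, exactly when \<open>A = 0\<close>).\<close>

definition numerical_radius_wrt ::
    "('a::complex_hilbert \<Rightarrow> 'a) \<Rightarrow> ('a \<Rightarrow> 'a) \<Rightarrow> ennreal"
  where "numerical_radius_wrt A T =
    (SUP x\<in>{x. norm_wrt A x = 1}. ennreal (cmod (cinner_wrt A (T x) x)))"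

definition rank_one_wrt :: "('a::complex_hilbert \<Rightarrow> 'a) \<Rightarrow> 'a \<Rightarrow> 'a \<Rightarrow> 'a \<Rightarrow> 'a"
  where "rank_one_wrt A x y = (\<lambda>z. cinner_wrt A z y *\<^sub>C x)"

end

theory Submission
  imports Defs
begin

text \<open>
  Write \<open>B\<close> for the positive square root of \<open>A\<close>, so that
  \<open>\<langle>x, y\<rangle>\<^sub>A = \<langle>B x, B y\<rangle>\<close> and \<open>\<parallel>x\<parallel>\<^sub>A = \<parallel>B x\<parallel>\<close>. The three conditions are
  proved in a cycle. If \<open>B T = c B S\<close> with \<open>\<bar>c\<bar> = 1\<close>, then \<open>\<bar>\<langle>T R x, x\<rangle>\<^sub>A\<bar> = \<bar>\<langle>S R x, x\<rangle>\<^sub>A\<bar>\<close> for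
  all \<open>R\<close> and \<open>x\<close>, so the radii agree. Next, \<open>T x \<otimes>\<^sub>A y\<close> is the product of \<open>T\<close> with
  \<open>x \<otimes>\<^sub>A y\<close>, and \<open>x \<otimes>\<^sub>A y\<close> has the \<open>B\<close>-adjoint \<open>z \<mapsto> \<langle>z, B x\<rangle> B y\<close>
  (\<open>rank_one_sqrt_adjointable\<close>).

  The substance is the way back from rank-one operators. Fix \<open>x\<close> and put \<open>u = T x\<close>, \<open>v = S x\<close>.
  Buzano's inequality \<open>2 \<bar>\<langle>v, z\<rangle> \<langle>z, y\<rangle>\<bar> \<le> \<bar>\<langle>v, y\<rangle>\<bar> + \<parallel>v\<parallel> \<parallel>y\<parallel>\<close> for unit vectors \<open>z\<close> bounds
  the radius of \<open>v \<otimes>\<^sub>A y\<close> from above, while the radius of \<open>u \<otimes>\<^sub>A u\<close> is at least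
  \<open>\<parallel>u\<parallel>\<^sub>A\<^sup>2\<close>. Taking \<open>y = u\<close> yields
  \<open>2 \<parallel>u\<parallel>\<^sub>A\<^sup>2 \<le> \<bar>\<langle>v, u\<rangle>\<^sub>A\<bar> + \<parallel>v\<parallel>\<^sub>A \<parallel>u\<parallel>\<^sub>A \<le> 2 \<parallel>v\<parallel>\<^sub>A \<parallel>u\<parallel>\<^sub>A\<close>,
  and \<open>y = v\<close> yields the same with \<open>u\<close> and \<open>v\<close> exchanged. Hence \<open>\<parallel>u\<parallel>\<^sub>A = \<parallel>v\<parallel>\<^sub>A\<close>, all
  these are equalities, and the equality case of Cauchy-Schwarz gives \<open>B T x = c B S x\<close> with
  \<open>\<bar>c\<bar> = 1\<close> depending on \<open>x\<close>
  (\<open>sqrt_op_unimodular_multiple_if_rank_one_radius_eq\<close>). Linearity then makes \<open>c\<close> independent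
  of \<open>x\<close> (\<open>pointwise_unimodular_multiple_imp_global\<close>).

  All of this presupposes that \<open>B\<close> exists and is unique. After scaling \<open>A\<close>, the operator
  \<open>C = I - A\<close> is a positive contraction and \<open>B = I - X\<close>, where \<open>X = (C + X\<^sup>2) / 2\<close>; the solution
  \<open>X\<close> is the limit of the iteration started at \<open>0\<close>, whose increments are dominated by those of
  the scalar iteration with \<open>C = 1\<close>.
\<close>

section \<open>Complex Hilbert spaces\<close>

instance complex_hilbert \<subseteq> banach ..

interpretation complex_vs: vector_space "scaleC :: complex \<Rightarrow> 'a \<Rightarrow> 'a::complex_hilbert"
proof
  show "1 *\<^sub>C x = x" for x :: 'a
    using scaleC_of_real[of 1 x] by simp
qed (auto simp: scaleC_add_right scaleC_add_left scaleC_scaleC)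

lemma scaleR_eq_scaleC: "r *\<^sub>R x = complex_of_real r *\<^sub>C (x::'a::complex_hilbert)"
  by (simp add: scaleC_of_real)

lemma cinner_scaleR_left: "cinner (r *\<^sub>R x) y = of_real r * cinner x y"
  by (simp add: scaleR_eq_scaleC cinner_scaleC_left)

lemma cinner_zero_left [simp]: "cinner 0 x = 0"
  using cinner_scaleR_left[of 0 0 x] by simp

lemma cinner_diff_left: "cinner (x - y) z = cinner x z - cinner y z"
  using cinner_add_left[of "x - y" y z] by simp

lemma cinner_add_right: "cinner x (y + z) = cinner x y + cinner x z"
  by (metis cinner_add_left cinner_commute complex_cnj_add)

lemma cinner_diff_right: "cinner x (y - z) = cinner x y - cinner x z"
  using cinner_add_right[of x "y - z" z] by simp

lemma cinner_scaleC_right: "cinner x (a *\<^sub>C y) = cnj a * cinner x y"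
  by (metis cinner_scaleC_left cinner_commute complex_cnj_mult)

lemma cinner_scaleR_right: "cinner x (r *\<^sub>R y) = of_real r * cinner x y"
  by (simp add: scaleR_eq_scaleC cinner_scaleC_right)

lemma cinner_zero_right [simp]: "cinner x 0 = 0"
  using cinner_scaleR_right[of x 0 0] by simp

lemmas cinner_bilinear_simps =
  cinner_add_left cinner_diff_left cinner_add_right cinner_diff_right
  cinner_scaleC_left cinner_scaleC_right cinner_scaleR_left cinner_scaleR_right

lemma cinner_self_eq_0_iff: "cinner x x = 0 \<longleftrightarrow> x = 0"
  by (simp add: cinner_self)

lemma norm_scaleC: "norm (a *\<^sub>C x) = cmod a * norm (x::'a::complex_hilbert)"
proof -
  have "complex_of_real ((norm (a *\<^sub>C x))\<^sup>2) = (a * cnj a) * complex_of_real ((norm x)\<^sup>2)"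
    by (simp only: cinner_self[symmetric] cinner_scaleC_left cinner_scaleC_right ac_simps)
  also have "\<dots> = complex_of_real ((cmod a * norm x)\<^sup>2)"
    by (simp add: complex_norm_square[symmetric] power_mult_distrib)
  finally have "(norm (a *\<^sub>C x))\<^sup>2 = (cmod a * norm x)\<^sup>2"
    by (simp only: of_real_eq_iff)
  then show ?thesis
    by (simp add: power2_eq_iff_nonneg)
qed

section \<open>Bounded and positive operators\<close>

lemma bounded_opsI:
  assumes "\<And>x y. T (x + y) = T x + T y" and "\<And>c x. T (c *\<^sub>C x) = c *\<^sub>C T x"
    and "\<And>x. norm (T x) \<le> norm x * K"
  shows "T \<in> bounded_ops"
proof -
  have "T (r *\<^sub>R x) = r *\<^sub>R T x" for r x
    by (simp add: scaleR_eq_scaleC assms(2))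
  then have "bounded_linear T"
    using assms(1,3) by (intro bounded_linear_intro)
  with assms(2) show ?thesis
    by (simp add: bounded_ops_def)
qed

lemma
  assumes "T \<in> bounded_ops"
  shows bounded_ops_bounded_linear: "bounded_linear T"
    and bounded_ops_add: "T (x + y) = T x + T y"
    and bounded_ops_diff: "T (x - y) = T x - T y"
    and bounded_ops_scaleC: "T (c *\<^sub>C x) = c *\<^sub>C T x"
    and bounded_ops_scaleR: "T (r *\<^sub>R x) = r *\<^sub>R T x"
    and bounded_ops_zero: "T 0 = 0"
proof -
  show 1: "bounded_linear T" and "T (c *\<^sub>C x) = c *\<^sub>C T x"
    using assms by (auto simp: bounded_ops_def)
  interpret bounded_linear T by (fact 1)
  show "T (x + y) = T x + T y" "T (x - y) = T x - T y" "T (r *\<^sub>R x) = r *\<^sub>R T x" "T 0 = 0"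
    by (auto simp: add diff scaleR zero)
qed

lemmas bounded_ops_simps =
  bounded_ops_add bounded_ops_diff bounded_ops_scaleC bounded_ops_scaleR

lemma positive_opD:
  assumes "positive_op A"
  shows "A \<in> bounded_ops" "Im (cinner (A x) x) = 0" "0 \<le> Re (cinner (A x) x)"
  using assms by (auto simp: positive_op_def complex_nonneg_Reals_iff)

lemma positive_opI:
  assumes "A \<in> bounded_ops" "\<And>x. Im (cinner (A x) x) = 0" "\<And>x. 0 \<le> Re (cinner (A x) x)"
  shows "positive_op A"
  using assms by (auto simp: positive_op_def complex_nonneg_Reals_iff)

text \<open>Polarization: the quadratic form is real at \<open>x + y\<close> and at \<open>x + \<i> y\<close>, which fixes the
  imaginary and the real part of \<open>\<langle>A x, y\<rangle>\<close> respectively in terms of \<open>\<langle>A y, x\<rangle>\<close>.\<close>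

lemma positive_op_hermitian:
  assumes "positive_op A"
  shows "cinner (A x) y = cinner x (A y)"
proof -
  note A = positive_opD[OF assms]
  have "Im (cinner (A (x + y)) (x + y)) = 0" "Im (cinner (A (x + \<i> *\<^sub>C y)) (x + \<i> *\<^sub>C y)) = 0"
    by (rule A)+
  then have "Im (cinner (A x) y) = - Im (cinner (A y) x)" "Re (cinner (A x) y) = Re (cinner (A y) x)"
    using A(2)[of x] A(2)[of y]
    by (simp_all add: bounded_ops_simps[OF A(1)] cinner_bilinear_simps)
  then have "cinner (A x) y = cnj (cinner (A y) x)"
    by (simp add: complex_eq_iff)
  then show ?thesis
    by (simp add: cinner_commute[of x])
qed

text \<open>Stated for the semi-inner product of a positive operator, this covers the inner product itself
  (\<open>B = I\<close>), shows that a form vanishing at \<open>x\<close> forces \<open>A x = 0\<close>, and bounds the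
  norm of a positive operator by its quadratic form.\<close>

lemma positive_op_cauchy_schwarz:
  assumes "positive_op A"
  shows "(cmod (cinner (A x) y))\<^sup>2 \<le> Re (cinner (A x) x) * Re (cinner (A y) y)"
proof -
  note A = positive_opD[OF assms]
  define a b c where "a = Re (cinner (A x) x)" and "b = Re (cinner (A y) y)"
    and "c = cinner (A x) y"
  have ab: "cinner (A x) x = of_real a" "cinner (A y) y = of_real b" "a \<ge> 0" "b \<ge> 0"
    using A by (auto simp: a_def b_def complex_eq_iff)
  have c': "cinner (A y) x = cnj c"
    unfolding c_def using positive_op_hermitian[OF assms] cinner_commute by metis
  \<comment> \<open>Rotating \<open>y\<close> by the phase of \<open>c\<close> leaves a real quadratic polynomial in \<open>r\<close>.\<close>
  have *: "0 \<le> a - 2 * r * (cmod c)\<^sup>2 + r\<^sup>2 * (cmod c)\<^sup>2 * b" for r :: real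
  proof -
    let ?z = "x - (of_real r * c) *\<^sub>C y"
    have "cinner (A ?z) ?z = of_real a - 2 * of_real r * (c * cnj c)
        + of_real r ^ 2 * (c * cnj c) * of_real b"
      by (simp add: bounded_ops_simps[OF A(1)] cinner_bilinear_simps ab c' c_def[symmetric]
          algebra_simps power2_eq_square)
    also have "\<dots> = of_real (a - 2 * r * (cmod c)\<^sup>2 + r\<^sup>2 * (cmod c)\<^sup>2 * b)"
      by (simp add: complex_norm_square[symmetric])
    finally show ?thesis
      using A(3)[of ?z] by simp
  qed
  have "(cmod c)\<^sup>2 \<le> a * b"
  proof (cases "b = 0")
    case True
    show ?thesis
    proof (rule ccontr)
      assume "\<not> ?thesis"
      with True have "c \<noteq> 0" by auto
      \<comment> \<open>Here the polynomial is linear with negative slope; this \<open>r\<close> makes its value \<open>-1\<close>.\<close>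
      with *[of "(a + 1) / (2 * (cmod c)\<^sup>2)"] True show False
        by simp
    qed
  next
    case False
    with ab *[of "1 / b"] show ?thesis
      by (simp add: field_simps power2_eq_square)
  qed
  then show ?thesis
    by (simp add: a_def b_def c_def)
qed

lemma positive_op_zero_form:
  assumes "positive_op A" "cinner (A x) x = 0"
  shows "A x = 0"
  using positive_op_cauchy_schwarz[OF assms(1), of x "A x"] assms(2)
  by (simp add: cinner_self_eq_0_iff)

lemma positive_op_id: "positive_op (\<lambda>x. x)"
  by (rule positive_opI) (auto intro!: bounded_opsI[where K = 1] simp: cinner_self)

lemma cinner_cauchy_schwarz: "cmod (cinner x y) \<le> norm x * norm y"
  using positive_op_cauchy_schwarz[OF positive_op_id, of x y]
  by (simp add: cinner_self power_mult_distrib[symmetric] power2_le_iff_abs_le)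

lemma bounded_linear_cinner_left: "bounded_linear (\<lambda>x. cinner x y)"
  by (rule bounded_linear_intro[where K = "norm y"])
    (auto simp: cinner_bilinear_simps scaleR_conv_of_real cinner_cauchy_schwarz)

section \<open>The positive square root\<close>

text \<open>Polynomials in \<open>C\<close> that approximate \<open>I - (I - C)\<^sup>1\<^sup>/\<^sup>2\<close>. Being built from \<open>C\<close> alone, they
  commute with everything that commutes with \<open>C\<close>; the limit inherits this, and the uniqueness of
  the square root rests on it.\<close>

primrec sqrt_iter :: "('a::complex_hilbert \<Rightarrow> 'a) \<Rightarrow> nat \<Rightarrow> 'a \<Rightarrow> 'a" where
  "sqrt_iter C 0 = (\<lambda>x. 0)"
| "sqrt_iter C (Suc n) = (\<lambda>x. (1/2) *\<^sub>R (C x + sqrt_iter C n (sqrt_iter C n x)))"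

text \<open>The iteration for \<open>C = 1\<close> on scalars. It increases and is bounded by \<open>1\<close>, so its increments are
  summable. Since the iteration polynomials have nonnegative coefficients, it dominates
  \<open>sqrt_iter\<close> in norm for every contraction \<open>C\<close>. This gives convergence without any gap
  \<open>\<parallel>C\<parallel> < 1\<close>, and such a gap is absent when \<open>A\<close> is not invertible.\<close>

primrec sqrt_majorant :: "nat \<Rightarrow> real" where
  "sqrt_majorant 0 = 0"
| "sqrt_majorant (Suc n) = (1 + (sqrt_majorant n)\<^sup>2) / 2"

lemma sqrt_majorant_bounds: "0 \<le> sqrt_majorant n" "sqrt_majorant n \<le> 1"
proof (induction n)
  case (Suc n)
  {
    case 1 show ?case by simp
  next
    case 2 show ?case using Suc by (simp add: power_le_one)
  }
qed auto

lemma sqrt_majorant_Suc_le: "sqrt_majorant n \<le> sqrt_majorant (Suc n)"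
  using sum_power2_ge_zero[of "1 - sqrt_majorant n" 0]
  by (simp add: power2_eq_square field_simps)

lemma convergent_sqrt_majorant: "convergent sqrt_majorant"
proof -
  have "incseq sqrt_majorant"
    using sqrt_majorant_Suc_le by (rule incseq_SucI)
  then show ?thesis
    using sqrt_majorant_bounds by (metis incseq_convergent convergent_def)
qed

context
  fixes C :: "'a::complex_hilbert \<Rightarrow> 'a"
  assumes C: "C \<in> bounded_ops" and contraction: "norm (C x) \<le> norm x"
begin

lemma norm_sqrt_iter_le: "norm (sqrt_iter C n x) \<le> sqrt_majorant n * norm x"
proof (induction n arbitrary: x)
  case (Suc n)
  have "norm (sqrt_iter C n (sqrt_iter C n x)) \<le> sqrt_majorant n * (sqrt_majorant n * norm x)"
    using Suc sqrt_majorant_bounds(1) by (meson mult_left_mono order_trans)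
  then have "norm (C x + sqrt_iter C n (sqrt_iter C n x))
      \<le> norm x + sqrt_majorant n * (sqrt_majorant n * norm x)"
    using contraction[of x] by (metis add_mono norm_triangle_le)
  then show ?case
    by (simp add: power2_eq_square ring_distribs mult_ac del: scaleR_add_right)
qed auto

lemma sqrt_iter_bounded_ops: "sqrt_iter C n \<in> bounded_ops"
proof (rule bounded_opsI)
  show "sqrt_iter C n (x + y) = sqrt_iter C n x + sqrt_iter C n y" for x y
    by (induction n arbitrary: x y) (auto simp: bounded_ops_simps[OF C] algebra_simps)
  show "sqrt_iter C n (c *\<^sub>C x) = c *\<^sub>C sqrt_iter C n x" for c x
    by (induction n arbitrary: c x)
      (auto simp: bounded_ops_simps[OF C] scaleR_eq_scaleC scaleC_scaleC scaleC_add_right mult_ac)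
  show "norm (sqrt_iter C n x) \<le> norm x * sqrt_majorant n" for x
    using norm_sqrt_iter_le[of n x] by (simp add: mult.commute)
qed

lemma norm_sqrt_iter_le_norm: "norm (sqrt_iter C n x) \<le> norm x"
  using norm_sqrt_iter_le[of n x] sqrt_majorant_bounds[of n]
  by (meson mult_left_le_one_le norm_ge_zero order_trans)

lemma sqrt_iter_commute:
  assumes "E \<in> bounded_ops" "\<And>x. E (C x) = C (E x)"
  shows "E (sqrt_iter C n x) = sqrt_iter C n (E x)"
  by (induction n arbitrary: x)
    (auto simp: assms(2) bounded_ops_simps[OF assms(1)] bounded_ops_zero[OF assms(1)])

lemma sqrt_iter_commute_sqrt_iter:
  "sqrt_iter C m (sqrt_iter C n x) = sqrt_iter C n (sqrt_iter C m x)"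
  by (intro sqrt_iter_commute sqrt_iter_bounded_ops, rule sqrt_iter_commute[symmetric]) (use C in auto)

text \<open>Consecutive iterates commute, so \<open>X\<^sub>n\<^sub>+\<^sub>1\<^sup>2 - X\<^sub>n\<^sup>2 = (X\<^sub>n\<^sub>+\<^sub>1 + X\<^sub>n) (X\<^sub>n\<^sub>+\<^sub>1 - X\<^sub>n)\<close>; the same
  factorization for the scalar iteration turns the norm estimate into an induction.\<close>

lemma norm_sqrt_iter_step_le:
  "norm (sqrt_iter C (Suc n) x - sqrt_iter C n x)
    \<le> (sqrt_majorant (Suc n) - sqrt_majorant n) * norm x"
proof (induction n arbitrary: x)
  case 0
  then show ?case using contraction[of x] by simp
next
  case (Suc n)
  let ?X = "sqrt_iter C" and ?s = "sqrt_majorant"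
  define d where "d = ?X (Suc n) x - ?X n x"
  have "?X (Suc n) d + ?X n d = ?X (Suc n) (?X (Suc n) x) - ?X n (?X n x)"
    unfolding d_def bounded_ops_diff[OF sqrt_iter_bounded_ops]
    using sqrt_iter_commute_sqrt_iter[of n "Suc n" x] by (simp del: sqrt_iter.simps)
  moreover have "?X (Suc (Suc n)) x - ?X (Suc n) x
      = (1/2) *\<^sub>R (?X (Suc n) (?X (Suc n) x) - ?X n (?X n x))"
    unfolding sqrt_iter.simps(2)[of C "Suc n"]
    by (subst (3) sqrt_iter.simps(2)) (simp del: sqrt_iter.simps add: algebra_simps)
  ultimately have "?X (Suc (Suc n)) x - ?X (Suc n) x = (1/2) *\<^sub>R (?X (Suc n) d + ?X n d)"
    by (simp only:)
  then have "norm (?X (Suc (Suc n)) x - ?X (Suc n) x) = norm (?X (Suc n) d + ?X n d) / 2"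
    by (simp del: sqrt_iter.simps)
  also have "\<dots> \<le> (?s (Suc n) * norm d + ?s n * norm d) / 2"
    using norm_sqrt_iter_le[of "Suc n" d] norm_sqrt_iter_le[of n d]
    by (intro divide_right_mono norm_triangle_le add_mono) auto
  also have "\<dots> = (?s (Suc n) + ?s n) / 2 * norm d"
    by (simp add: field_simps)
  also have "\<dots> \<le> (?s (Suc n) + ?s n) / 2 * ((?s (Suc n) - ?s n) * norm x)"
    unfolding d_def by (intro mult_left_mono Suc) (simp_all add: sqrt_majorant_bounds)
  also have "\<dots> = (?s (Suc (Suc n)) - ?s (Suc n)) * norm x"
  proof -
    have "2 * ?s (Suc n) = 1 + (?s n)\<^sup>2" "2 * ?s (Suc (Suc n)) = 1 + (?s (Suc n))\<^sup>2"
      by simp_all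
    then have "(?s (Suc n) + ?s n) / 2 * (?s (Suc n) - ?s n) = ?s (Suc (Suc n)) - ?s (Suc n)"
      by (simp add: power2_eq_square field_simps del: sqrt_majorant.simps)
    then show ?thesis
      by (simp only: mult.assoc[symmetric])
  qed
  finally show ?case .
qed

lemma convergent_sqrt_iter: "convergent (\<lambda>n. sqrt_iter C n x)"
proof -
  have "summable (\<lambda>n. (sqrt_majorant (Suc n) - sqrt_majorant n) * norm x)"
    using convergent_sqrt_majorant
    by (intro summable_mult2) (metis convergent_def telescope_summable)
  then have "summable (\<lambda>n. norm (sqrt_iter C (Suc n) x - sqrt_iter C n x))"
    by (rule summable_comparison_test'[where N = 0]) (simp add: norm_sqrt_iter_step_le del: sqrt_iter.simps sqrt_majorant.simps)
  then have "Cauchy (\<lambda>n. \<Sum>k<n. sqrt_iter C (Suc k) x - sqrt_iter C k x)"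
    by (rule LIMSEQ_imp_Cauchy[OF summable_LIMSEQ[OF summable_norm_cancel]])
  then have "Cauchy (\<lambda>n. sqrt_iter C n x)"
    unfolding sum_lessThan_telescope[of "\<lambda>n. sqrt_iter C n x"] by simp
  then show ?thesis
    by (rule Cauchy_convergent)
qed

definition sqrt_limit :: "'a \<Rightarrow> 'a" where
  "sqrt_limit x = lim (\<lambda>n. sqrt_iter C n x)"

lemma sqrt_limit: "(\<lambda>n. sqrt_iter C n x) \<longlonglongrightarrow> sqrt_limit x"
  unfolding sqrt_limit_def using convergent_sqrt_iter convergent_LIMSEQ_iff by blast

lemma norm_sqrt_limit_le: "norm (sqrt_limit x) \<le> norm x"
  by (rule LIMSEQ_le_const2[OF tendsto_norm[OF sqrt_limit]]) (use norm_sqrt_iter_le_norm in auto)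

lemma sqrt_limit_commute:
  assumes "E \<in> bounded_ops" "\<And>x. E (C x) = C (E x)"
  shows "E (sqrt_limit x) = sqrt_limit (E x)"
proof (rule LIMSEQ_unique[OF _ sqrt_limit])
  show "(\<lambda>n. sqrt_iter C n (E x)) \<longlonglongrightarrow> E (sqrt_limit x)"
    using bounded_linear.tendsto[OF bounded_ops_bounded_linear[OF assms(1)] sqrt_limit[of x]]
    by (simp add: sqrt_iter_commute[OF assms])
qed

lemma sqrt_limit_bounded_ops: "sqrt_limit \<in> bounded_ops"
proof (rule bounded_opsI[where K = 1])
  show "sqrt_limit (x + y) = sqrt_limit x + sqrt_limit y" for x y
    by (rule LIMSEQ_unique[OF sqrt_limit])
      (use tendsto_add[OF sqrt_limit sqrt_limit, of x y] in
        \<open>simp add: bounded_ops_simps[OF sqrt_iter_bounded_ops]\<close>)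
  have "(\<lambda>x. c *\<^sub>C x) \<in> bounded_ops" for c :: complex
    by (rule bounded_opsI[where K = "cmod c"])
      (simp_all add: scaleC_add_right scaleC_scaleC norm_scaleC mult_ac)
  from sqrt_limit_commute[OF this]
  show "sqrt_limit (c *\<^sub>C x) = c *\<^sub>C sqrt_limit x" for c x
    by (simp add: bounded_ops_simps[OF C])
qed (simp add: norm_sqrt_limit_le)

text \<open>All iterates are contractions, so \<open>X\<^sub>n (X\<^sub>n x - X x)\<close> tends to \<open>0\<close>, and pointwise
  convergence of \<open>X\<^sub>n\<close> is enough to pass to the limit in \<open>X\<^sub>n (X\<^sub>n x)\<close>.\<close>

lemma sqrt_limit_fixed_point: "2 *\<^sub>R sqrt_limit x = C x + sqrt_limit (sqrt_limit x)"
proof -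
  let ?X = "sqrt_iter C" and ?L = sqrt_limit
  have "(\<lambda>n. ?X n x - ?L x) \<longlonglongrightarrow> 0"
    using sqrt_limit[of x] by (simp add: LIM_zero_iff)
  then have "(\<lambda>n. ?X n (?X n x - ?L x)) \<longlonglongrightarrow> 0"
    by (rule Lim_null_comparison[rotated, OF tendsto_norm_zero]) (simp add: norm_sqrt_iter_le_norm)
  from tendsto_add[OF this sqrt_limit[of "?L x"]]
  have "(\<lambda>n. ?X n (?X n x)) \<longlonglongrightarrow> ?L (?L x)"
    by (simp add: bounded_ops_simps[OF sqrt_iter_bounded_ops])
  then have "(\<lambda>n. ?X (Suc n) x) \<longlonglongrightarrow> (1/2) *\<^sub>R (C x + ?L (?L x))"
    unfolding sqrt_iter.simps by (intro tendsto_intros)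
  then have "?L x = (1/2) *\<^sub>R (C x + ?L (?L x))"
    using LIMSEQ_Suc[OF sqrt_limit] LIMSEQ_unique by blast
  then show ?thesis
    by (metis scaleR_half_double scaleR_2 scaleR_add_right)
qed

text \<open>With \<open>X\<close> the limit, \<open>(I - X)\<^sup>2 = I - 2 X + X\<^sup>2 = I - C\<close>.\<close>

lemma sqrt_limit_complement_square:
  "(x - sqrt_limit x) - sqrt_limit (x - sqrt_limit x) = x - C x"
  using sqrt_limit_fixed_point[of x]
  by (simp add: bounded_ops_simps[OF sqrt_limit_bounded_ops] scaleR_2 algebra_simps)

lemma sqrt_limit_complement_positive:
  assumes herm: "\<And>x y. cinner (C x) y = cinner x (C y)"
  shows "positive_op (\<lambda>x. x - sqrt_limit x)"
proof (rule positive_opI)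
  show "(\<lambda>x. x - sqrt_limit x) \<in> bounded_ops"
  proof (rule bounded_opsI[where K = 2])
    show "norm (x - sqrt_limit x) \<le> norm x * 2" for x
      using norm_triangle_ineq4[of x "sqrt_limit x"] norm_sqrt_limit_le[of x] by simp
  qed (simp_all add: bounded_ops_simps[OF sqrt_limit_bounded_ops] complex_vs.scale_right_diff_distrib)
next
  fix x
  have iter: "cinner (sqrt_iter C n x) y = cinner x (sqrt_iter C n y)" for n x y
    by (induction n arbitrary: x y) (simp_all add: cinner_bilinear_simps herm)
  then have "Im (cinner (sqrt_iter C n x) x) = 0" for n
    using cinner_commute[of "sqrt_iter C n x" x] by (simp add: complex_eq_iff)
  moreover have "(\<lambda>n. Im (cinner (sqrt_iter C n x) x)) \<longlonglongrightarrow> Im (cinner (sqrt_limit x) x)"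
    by (intro tendsto_Im bounded_linear.tendsto[OF bounded_linear_cinner_left] sqrt_limit)
  ultimately show "Im (cinner (x - sqrt_limit x) x) = 0"
    by (simp add: cinner_diff_left cinner_self LIMSEQ_const_iff)
  have "Re (cinner (sqrt_limit x) x) \<le> norm (sqrt_limit x) * norm x"
    using complex_Re_le_cmod cinner_cauchy_schwarz order_trans by blast
  also have "\<dots> \<le> norm x * norm x"
    by (intro mult_right_mono norm_sqrt_limit_le) simp
  finally show "0 \<le> Re (cinner (x - sqrt_limit x) x)"
    by (simp add: cinner_diff_left cinner_self power2_eq_square)
qed

end

text \<open>Cauchy-Schwarz for the form of \<open>C\<close> at \<open>x\<close> and \<open>C x\<close> gives
  \<open>\<parallel>C x\<parallel>\<^sup>4 \<le> \<langle>C x, x\<rangle> \<langle>C C x, C x\<rangle> \<le> \<parallel>x\<parallel>\<^sup>2 \<parallel>C x\<parallel>\<^sup>2\<close>.\<close>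

lemma positive_op_contraction:
  assumes "positive_op C" and "\<And>x. Re (cinner (C x) x) \<le> (norm x)\<^sup>2"
  shows "norm (C x) \<le> norm x"
proof -
  have "((norm (C x))\<^sup>2)\<^sup>2 = (cmod (cinner (C x) (C x)))\<^sup>2"
    by (simp add: cinner_self norm_power)
  also have "\<dots> \<le> Re (cinner (C x) x) * Re (cinner (C (C x)) (C x))"
    by (rule positive_op_cauchy_schwarz[OF assms(1)])
  also have "\<dots> \<le> (norm x)\<^sup>2 * (norm (C x))\<^sup>2"
    by (intro mult_mono assms positive_opD) simp
  finally have "(norm (C x))\<^sup>2 * (norm (C x))\<^sup>2 \<le> (norm x)\<^sup>2 * (norm (C x))\<^sup>2"
    by (simp add: power2_eq_square)
  then have "(norm (C x))\<^sup>2 \<le> (norm x)\<^sup>2" if "C x \<noteq> 0"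
    using that by (simp only: mult_le_cancel_right) simp
  then show ?thesis
    by (cases "C x = 0") (auto intro: power2_le_imp_le)
qed

lemma positive_op_scaleR:
  assumes "positive_op B" "0 \<le> r"
  shows "positive_op (\<lambda>x. r *\<^sub>R B x)"
proof (rule positive_opI)
  note B = positive_opD[OF assms(1)]
  obtain K where K: "\<And>x. norm (B x) \<le> norm x * K"
    using bounded_linear.bounded[OF bounded_ops_bounded_linear[OF B(1)]] by blast
  show "(\<lambda>x. r *\<^sub>R B x) \<in> bounded_ops"
  proof (rule bounded_opsI[where K = "r * K"])
    show "norm (r *\<^sub>R B x) \<le> norm x * (r * K)" for x
      using mult_left_mono[OF K \<open>0 \<le> r\<close>, of x] \<open>0 \<le> r\<close> by (simp add: mult_ac)
  qed (simp_all add: bounded_ops_simps[OF B(1)] scaleR_eq_scaleC scaleC_add_right scaleC_scaleC mult_ac)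
  show "Im (cinner (r *\<^sub>R B x) x) = 0" "0 \<le> Re (cinner (r *\<^sub>R B x) x)" for x
    using B(2,3)[of x] assms(2) by (simp_all add: cinner_bilinear_simps)
qed

text \<open>The commutation clause is what the uniqueness proof needs: any other square root of \<open>A\<close>
  commutes with \<open>A\<close>, hence with the root constructed here.\<close>

lemma ex_positive_sqrt:
  assumes "positive_op A"
  shows "\<exists>B. positive_op B \<and> B \<circ> B = A \<and>
    (\<forall>E\<in>bounded_ops. (\<forall>y. E (A y) = A (E y)) \<longrightarrow> (\<forall>x. E (B x) = B (E x)))"
proof -
  note A = positive_opD[OF assms]
  obtain M where M: "M > 0" "\<And>x. norm (A x) \<le> norm x * M"
    using bounded_linear.pos_bounded[OF bounded_ops_bounded_linear[OF A(1)]] by blast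
  \<comment> \<open>Dividing by a norm bound \<open>M\<close> gives \<open>0 \<le> A / M \<le> I\<close>, so that \<open>C\<close> is positive and a contraction.\<close>
  define C where "C = (\<lambda>x. x - (1/M) *\<^sub>R A x)"
  have C: "C \<in> bounded_ops"
  proof (rule bounded_opsI[where K = 2])
    show "norm (C x) \<le> norm x * 2" for x
    proof -
      have "norm ((1/M) *\<^sub>R A x) \<le> norm x"
        using M by (simp add: pos_divide_le_eq)
      then show ?thesis
        using norm_triangle_ineq4[of x "(1/M) *\<^sub>R A x"] by (simp add: C_def)
    qed
  qed (simp_all add: C_def bounded_ops_simps[OF A(1)] scaleR_eq_scaleC scaleC_add_right
      scaleC_scaleC complex_vs.scale_right_diff_distrib mult_ac)
  have form: "cinner (C x) x = (norm x)\<^sup>2 - cinner (A x) x / M" for x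
    by (simp add: C_def cinner_bilinear_simps cinner_self)
  have posC: "positive_op C"
  proof (rule positive_opI[OF C])
    fix x
    show "Im (cinner (C x) x) = 0"
      by (simp add: form A)
    have "Re (cinner (A x) x) \<le> norm (A x) * norm x"
      using complex_Re_le_cmod cinner_cauchy_schwarz order_trans by blast
    also have "\<dots> \<le> (norm x * M) * norm x"
      by (intro mult_right_mono M) simp
    finally show "0 \<le> Re (cinner (C x) x)"
      using M(1) by (simp add: form field_simps power2_eq_square)
  qed
  have contr: "norm (C x) \<le> norm x" for x
    by (rule positive_op_contraction[OF posC]) (use A(3) M(1) in \<open>simp add: form\<close>)
  define B where "B = (\<lambda>x. sqrt M *\<^sub>R (x - sqrt_limit C x))"
  note L = sqrt_limit_bounded_ops[OF C contr]
  have "positive_op B"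
    unfolding B_def
    by (intro positive_op_scaleR sqrt_limit_complement_positive C contr positive_op_hermitian posC)
      (use M(1) in simp)
  moreover have "B (B x) = A x" for x
  proof -
    have "B (B x) = M *\<^sub>R ((x - sqrt_limit C x) - sqrt_limit C (x - sqrt_limit C x))"
      using M(1) by (simp add: B_def bounded_ops_scaleR[OF L] flip: scaleR_diff_right)
    also have "\<dots> = A x"
      using M(1) by (simp only: sqrt_limit_complement_square[OF C contr]) (simp add: C_def)
    finally show ?thesis .
  qed
  moreover have "E (B x) = B (E x)" if "E \<in> bounded_ops" "\<And>y. E (A y) = A (E y)" for E x
  proof -
    have "E (C y) = C (E y)" for y
      by (simp add: C_def bounded_ops_simps[OF that(1)] that(2))
    then show ?thesis
      by (simp add: B_def bounded_ops_simps[OF that(1)] sqrt_limit_commute[OF C contr that(1)])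
  qed
  ultimately show ?thesis
    by (intro exI[of _ B]) (simp add: fun_eq_iff)
qed

text \<open>With \<open>y = (B - B') x\<close>, commutativity gives
  \<open>\<langle>B y, y\<rangle> + \<langle>B' y, y\<rangle> = \<langle>(B\<^sup>2 - B'\<^sup>2) x, y\<rangle> = 0\<close>. Both summands are nonnegative, so
  \<open>B y = B' y = 0\<close>, and \<open>\<parallel>y\<parallel>\<^sup>2 = \<langle>x, (B - B') y\<rangle> = 0\<close>.\<close>

lemma positive_sqrt_unique:
  assumes "positive_op B" "positive_op B'" "\<And>x. B (B x) = B' (B' x)" "\<And>x. B (B' x) = B' (B x)"
  shows "B = B'"
proof
  fix x
  note B = positive_opD[OF assms(1)] and B' = positive_opD[OF assms(2)]
  define y where "y = B x - B' x"
  have "B y + B' y = 0"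
    by (simp add: y_def bounded_ops_simps[OF B(1)] bounded_ops_simps[OF B'(1)] assms(3,4))
  then have "cinner (B y) y + cinner (B' y) y = 0"
    by (simp add: cinner_add_left[symmetric])
  then have "cinner (B y) y = 0" "cinner (B' y) y = 0"
    using B(2,3)[of y] B'(2,3)[of y] by (simp_all add: complex_eq_iff)
  then have "B y = 0" "B' y = 0"
    using positive_op_zero_form assms by blast+
  then have "cinner y y = 0"
    using positive_op_hermitian[OF assms(1), of x y] positive_op_hermitian[OF assms(2), of x y]
    by (subst (1) y_def) (simp add: cinner_diff_left)
  then show "B x = B' x"
    by (simp add: cinner_self_eq_0_iff y_def)
qed

lemma
  assumes "positive_op A"
  shows positive_op_sqrt_op: "positive_op (sqrt_op A)"
    and sqrt_op_square: "sqrt_op A (sqrt_op A x) = A x"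
proof -
  obtain B where B: "positive_op B" "B \<circ> B = A"
    "\<And>E x. E \<in> bounded_ops \<Longrightarrow> (\<And>y. E (A y) = A (E y)) \<Longrightarrow> E (B x) = B (E x)"
    using ex_positive_sqrt[OF assms] by metis
  have "B' = B" if "positive_op B' \<and> B' \<circ> B' = A" for B'
  proof (rule positive_sqrt_unique)
    show "B' (B x) = B (B' x)" for x
    proof (rule B(3))
      have "B' (B' y) = A y" for y
        using that by (auto simp: fun_eq_iff)
      then show "B' (A y) = A (B' y)" for y
        by metis
    qed (use that positive_opD in blast)
  qed (use that B in \<open>auto simp: o_def fun_eq_iff\<close>)
  with B(1,2) have "sqrt_op A = B"
    unfolding sqrt_op_def by (intro the_equality conjI)
  then show "positive_op (sqrt_op A)" "sqrt_op A (sqrt_op A x) = A x"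
    using B(1) fun_cong[OF B(2), of x] by simp_all
qed

section \<open>The semi-inner product induced by a positive operator\<close>

lemma cinner_wrt_eq_sqrt:
  "positive_op A \<Longrightarrow> cinner_wrt A x y = cinner (sqrt_op A x) (sqrt_op A y)"
  by (simp add: cinner_wrt_def positive_op_hermitian[OF positive_op_sqrt_op, symmetric]
      sqrt_op_square)

lemma norm_wrt_eq_sqrt: "positive_op A \<Longrightarrow> norm_wrt A x = norm (sqrt_op A x)"
  by (simp add: norm_wrt_def cinner_wrt_eq_sqrt cinner_self)

text \<open>The vector \<open>x' = 2 \<langle>x, z\<rangle> z - x\<close> is the reflection of \<open>x\<close> in the line spanned by \<open>z\<close>, so it has
  the norm of \<open>x\<close>. Cauchy-Schwarz for \<open>\<langle>x', y\<rangle>\<close> and the triangle inequality give the bound.\<close>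

lemma buzano_inequality:
  assumes "norm z = 1"
  shows "2 * cmod (cinner z y * cinner x z) \<le> cmod (cinner x y) + norm x * norm y"
proof -
  define x' where "x' = (2 * cinner x z) *\<^sub>C z - x"
  have zx: "cinner z x = cnj (cinner x z)"
    by (rule cinner_commute)
  have "cinner x' x' = cinner x x"
    by (simp add: x'_def cinner_bilinear_simps zx cinner_self[of z] assms)
  then have "norm x' = norm x"
    by (simp add: cinner_self flip: of_real_power)
  then have "cmod (cinner x' y) \<le> norm x * norm y"
    using cinner_cauchy_schwarz[of x' y] by simp
  moreover have "2 * (cinner z y * cinner x z) = cinner x y + cinner x' y"
    by (simp add: x'_def cinner_bilinear_simps)
  then have "2 * cmod (cinner z y * cinner x z) = cmod (cinner x y + cinner x' y)"
    by (metis norm_mult norm_numeral)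
  ultimately show ?thesis
    using norm_triangle_ineq[of "cinner x y" "cinner x' y"] by linarith
qed

lemma cauchy_schwarz_equality:
  assumes "cmod (cinner x y) = norm x * norm y" "norm x = norm y"
  obtains c where "cmod c = 1" "x = c *\<^sub>C (y::'a::complex_hilbert)"
proof (cases "y = 0")
  case True
  then show thesis using that[of 1] assms(2) by simp
next
  case False
  define c where "c = cinner x y / (norm y)\<^sup>2"
  have c: "cmod c = 1"
    using False assms by (simp add: c_def norm_divide norm_mult power2_eq_square)
  have xy: "cinner x y = c * (norm y)\<^sup>2"
    using False by (simp add: c_def)
  then have yx: "cinner y x = cnj c * (norm y)\<^sup>2"
    by (subst cinner_commute) simp
  have "c * cnj c = 1"
    using c by (simp add: complex_norm_square[symmetric])
  then have "cinner (x - c *\<^sub>C y) (x - c *\<^sub>C y) = 0"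
    by (simp add: cinner_bilinear_simps xy yx cinner_self[of x] cinner_self[of y] assms(2) algebra_simps)
  then have "x = c *\<^sub>C y"
    by (simp add: cinner_self_eq_0_iff)
  with c that show thesis by blast
qed

lemma numerical_radius_rank_one_le:
  assumes "positive_op A"
  shows "numerical_radius_wrt A (rank_one_wrt A u y)
    \<le> ennreal ((cmod (cinner_wrt A u y) + norm_wrt A u * norm_wrt A y) / 2)"
  unfolding numerical_radius_wrt_def
proof (rule SUP_least, rule ennreal_leI)
  fix z assume "z \<in> {z. norm_wrt A z = 1}"
  then have "norm (sqrt_op A z) = 1"
    by (simp add: norm_wrt_eq_sqrt assms)
  from buzano_inequality[OF this]
  have "2 * cmod (cinner_wrt A z y * cinner_wrt A u z)
      \<le> cmod (cinner_wrt A u y) + norm_wrt A u * norm_wrt A y"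
    by (simp add: norm_wrt_eq_sqrt cinner_wrt_eq_sqrt assms)
  moreover have "cinner_wrt A (rank_one_wrt A u y z) z = cinner_wrt A z y * cinner_wrt A u z"
    by (simp add: rank_one_wrt_def cinner_wrt_def cinner_scaleC_left
        bounded_ops_scaleC[OF positive_opD(1)[OF assms]])
  ultimately show "cmod (cinner_wrt A (rank_one_wrt A u y z) z)
      \<le> (cmod (cinner_wrt A u y) + norm_wrt A u * norm_wrt A y) / 2"
    by simp
qed

text \<open>The supremum is tested at \<open>u\<close> normalized with respect to \<open>\<parallel>\<cdot>\<parallel>\<^sub>A\<close>; together with the upper
  bound this is the exact value of the radius.\<close>

lemma numerical_radius_rank_one_self_ge:
  assumes "positive_op A"
  shows "ennreal ((norm_wrt A u)\<^sup>2) \<le> numerical_radius_wrt A (rank_one_wrt A u u)"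
proof (cases "norm_wrt A u = 0")
  case False
  note A = positive_opD(1)[OF assms] and n = norm_wrt_eq_sqrt[OF assms]
  note B = positive_opD(1)[OF positive_op_sqrt_op[OF assms]]
  define z where "z = (1 / norm_wrt A u) *\<^sub>R u"
  have u: "cinner_wrt A u u = of_real ((norm_wrt A u)\<^sup>2)"
    by (simp add: n cinner_wrt_eq_sqrt assms cinner_self)
  have "norm_wrt A z = 1"
    using False by (simp add: n z_def bounded_ops_scaleR[OF B])
  moreover have "cinner_wrt A (rank_one_wrt A u u z) z = of_real ((norm_wrt A u)\<^sup>2)"
    using False u
    by (simp add: rank_one_wrt_def z_def cinner_wrt_def bounded_ops_simps[OF A]
        cinner_bilinear_simps power2_eq_square)
  then have "cmod (cinner_wrt A (rank_one_wrt A u u z) z) = (norm_wrt A u)\<^sup>2"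
    by (simp add: norm_power n)
  ultimately show ?thesis
    unfolding numerical_radius_wrt_def by (intro SUP_upper2[of z]) auto
qed simp

text \<open>The radii are compared only for \<open>u \<noteq> 0\<close> because the rank-one condition of the equivalence
  excludes a zero second vector; this is where \<open>T x = 0\<close> or \<open>S x = 0\<close> is absorbed.\<close>

lemma norm_wrt_sq_le_if_rank_one_radius_eq:
  assumes "positive_op A"
    and "u \<noteq> 0 \<Longrightarrow> numerical_radius_wrt A (rank_one_wrt A u u)
      = numerical_radius_wrt A (rank_one_wrt A v u)"
  shows "2 * (norm_wrt A u)\<^sup>2 \<le> cmod (cinner_wrt A v u) + norm_wrt A v * norm_wrt A u"
proof (cases "u = 0")
  case True
  then have "norm_wrt A u = 0"
    by (simp add: norm_wrt_def cinner_wrt_def)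
  then show ?thesis by simp
next
  case False
  have "0 \<le> (cmod (cinner_wrt A v u) + norm_wrt A v * norm_wrt A u) / 2"
    by (simp add: norm_wrt_eq_sqrt assms(1))
  then have "(norm_wrt A u)\<^sup>2 \<le> (cmod (cinner_wrt A v u) + norm_wrt A v * norm_wrt A u) / 2"
    using numerical_radius_rank_one_self_ge[OF assms(1), of u]
      numerical_radius_rank_one_le[OF assms(1), of v u] assms(2)[OF False]
    by (metis ennreal_le_iff order_trans)
  then show ?thesis by simp
qed

text \<open>The choices \<open>y = u\<close> and \<open>y = v\<close> bound \<open>\<parallel>u\<parallel>\<^sub>A\<^sup>2\<close> and \<open>\<parallel>v\<parallel>\<^sub>A\<^sup>2\<close> by
  \<open>\<parallel>u\<parallel>\<^sub>A \<parallel>v\<parallel>\<^sub>A\<close>. Adding the two bounds gives \<open>(\<parallel>u\<parallel>\<^sub>A - \<parallel>v\<parallel>\<^sub>A)\<^sup>2 \<le> 0\<close>, and then equality holds in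
  Cauchy-Schwarz.\<close>

lemma sqrt_op_unimodular_multiple_if_rank_one_radius_eq:
  assumes A: "positive_op A"
    and eq: "\<And>y. y \<noteq> 0 \<Longrightarrow> numerical_radius_wrt A (rank_one_wrt A u y)
      = numerical_radius_wrt A (rank_one_wrt A v y)"
  obtains c where "cmod c = 1" "sqrt_op A u = c *\<^sub>C sqrt_op A v"
proof -
  let ?u = "sqrt_op A u" and ?v = "sqrt_op A v"
  have cs: "cmod (cinner ?u ?v) \<le> norm ?u * norm ?v"
    by (rule cinner_cauchy_schwarz)
  have sym: "cmod (cinner ?v ?u) = cmod (cinner ?u ?v)"
    by (metis cinner_commute complex_mod_cnj)
  have uv: "2 * (norm ?u)\<^sup>2 \<le> cmod (cinner ?u ?v) + norm ?u * norm ?v"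
    using norm_wrt_sq_le_if_rank_one_radius_eq[OF A, of u v] eq sym
    by (simp add: norm_wrt_eq_sqrt cinner_wrt_eq_sqrt A mult.commute)
  have vu: "2 * (norm ?v)\<^sup>2 \<le> cmod (cinner ?u ?v) + norm ?u * norm ?v"
    using norm_wrt_sq_le_if_rank_one_radius_eq[OF A, of v u] eq sym
    by (simp add: norm_wrt_eq_sqrt cinner_wrt_eq_sqrt A mult.commute)
  have "(norm ?u - norm ?v)\<^sup>2 \<le> 0"
    unfolding power2_diff using uv vu cs by linarith
  then have "norm ?u = norm ?v"
    by simp
  moreover from this have "cmod (cinner ?u ?v) = norm ?u * norm ?v"
    using uv cs by (simp add: power2_eq_square)
  ultimately show thesis
    using cauchy_schwarz_equality that by blast
qed

section \<open>The equivalence\<close>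

lemma adjoint_op_eqI:
  assumes "R \<in> bounded_ops" "\<And>x y. cinner (T x) y = cinner x (R y)"
  shows "adjoint_op T = R"
  unfolding adjoint_op_def
proof (rule the_equality)
  fix R' assume R': "R' \<in> bounded_ops \<and> (\<forall>x y. cinner (T x) y = cinner x (R' y))"
  have "cinner (R' y - R y) (R' y - R y) = 0" for y
    using R' assms(2) by (metis cinner_diff_right right_minus_eq)
  then show "R' = R"
    by (simp add: cinner_self_eq_0_iff fun_eq_iff)
qed (use assms in auto)

lemma rank_one_bounded_ops:
  shows "(\<lambda>z. cinner z y *\<^sub>C x) \<in> bounded_ops"
proof (rule bounded_opsI[where K = "norm y * norm x"])
  show "norm (cinner z y *\<^sub>C x) \<le> norm z * (norm y * norm x)" for z
    using mult_right_mono[OF cinner_cauchy_schwarz, of "norm x" z y]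
    by (simp add: norm_scaleC mult_ac)
qed (simp_all add: cinner_bilinear_simps scaleC_add_left scaleC_scaleC)

text \<open>The adjoint of \<open>x \<otimes>\<^sub>A y\<close> is \<open>z \<mapsto> \<langle>z, x\<rangle> A y\<close>. Since \<open>\<langle>B z, x\<rangle> = \<langle>z, B x\<rangle>\<close> and
  \<open>A y = B (B y)\<close>, following \<open>B\<close> by this adjoint is the same as following the rank-one operator
  \<open>z \<mapsto> \<langle>z, B x\<rangle> B y\<close> by \<open>B\<close>.\<close>

lemma rank_one_sqrt_adjointable:
  assumes "positive_op A"
  shows "rank_one_wrt A x y \<in> sqrt_adjointable_ops A"
proof -
  let ?B = "sqrt_op A"
  note A = positive_op_hermitian[OF assms]
  note B = positive_opD(1)[OF positive_op_sqrt_op[OF assms]]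
    positive_op_hermitian[OF positive_op_sqrt_op[OF assms]]
  have rank_one: "rank_one_wrt A x y = (\<lambda>z. cinner z (A y) *\<^sub>C x)"
    by (simp add: rank_one_wrt_def cinner_wrt_def A)
  have "adjoint_op (rank_one_wrt A x y) = (\<lambda>z. cinner z x *\<^sub>C A y)"
  proof (rule adjoint_op_eqI[OF rank_one_bounded_ops])
    show "cinner (rank_one_wrt A x y z) w = cinner z (cinner w x *\<^sub>C A y)" for z w
      by (simp add: rank_one cinner_bilinear_simps cinner_commute[of w x])
  qed
  then have "?B \<circ> (\<lambda>z. cinner z (?B x) *\<^sub>C ?B y) = adjoint_op (rank_one_wrt A x y) \<circ> ?B"
    by (simp add: fun_eq_iff bounded_ops_scaleC[OF B(1)] sqrt_op_square[OF assms] B(2))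
  moreover have "rank_one_wrt A x y \<in> bounded_ops"
    unfolding rank_one by (rule rank_one_bounded_ops)
  ultimately show ?thesis
    unfolding sqrt_adjointable_ops_def using rank_one_bounded_ops by blast
qed

text \<open>Take \<open>c\<close> from a vector \<open>x0\<close> with \<open>g x0 \<noteq> 0\<close>. If \<open>g x\<close> and \<open>g x0\<close> are linearly independent,
  comparing coefficients in \<open>f (x + x0) = f x + f x0\<close> identifies the three factors. If \<open>g x = k g x0\<close>,
  then \<open>g\<close> and therefore \<open>f\<close> vanishes at \<open>x - k x0\<close>.\<close>

lemma pointwise_unimodular_multiple_imp_global:
  fixes f g :: "'a::complex_hilbert \<Rightarrow> 'b::complex_hilbert"
  assumes f: "\<And>x y. f (x + y) = f x + f y" "\<And>k x. f (k *\<^sub>C x) = k *\<^sub>C f x"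
    and g: "\<And>x y. g (x + y) = g x + g y" "\<And>k x. g (k *\<^sub>C x) = k *\<^sub>C g x"
    and pointwise: "\<And>x. \<exists>c. cmod c = 1 \<and> f x = c *\<^sub>C g x"
  obtains c where "cmod c = 1" "\<And>x. f x = c *\<^sub>C g x"
proof (cases "\<forall>x. g x = 0")
  case True
  then show thesis using pointwise that[of 1] by fastforce
next
  case False
  then obtain x0 where x0: "g x0 \<noteq> 0" by blast
  obtain c where c: "cmod c = 1" "f x0 = c *\<^sub>C g x0"
    using pointwise by blast
  have "f x = c *\<^sub>C g x" for x
  proof (cases "\<exists>k. g x = k *\<^sub>C g x0")
    case True
    then obtain k where k: "g x = k *\<^sub>C g x0" by blast
    have "g (x + (- k) *\<^sub>C x0) = 0"
      unfolding g by (simp add: k)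
    then have "f (x + (- k) *\<^sub>C x0) = 0"
      using pointwise by (metis complex_vs.scale_zero_right)
    then have "f x = k *\<^sub>C f x0"
      unfolding f by simp
    then show ?thesis
      by (simp add: c k scaleC_scaleC mult.commute)
  next
    case indep: False
    obtain a b where a: "f x = a *\<^sub>C g x" and b: "f (x + x0) = b *\<^sub>C g (x + x0)"
      using pointwise by blast
    have rel: "(a - b) *\<^sub>C g x = (b - c) *\<^sub>C g x0"
      using a b c(2)
      by (simp add: f g scaleC_add_right complex_vs.scale_left_diff_distrib algebra_simps)
    have "a = b"
    proof (rule ccontr)
      assume "a \<noteq> b"
      then have "g x = ((b - c) / (a - b)) *\<^sub>C g x0"
        using arg_cong[OF rel, of "\<lambda>v. (1 / (a - b)) *\<^sub>C v"] by (simp add: scaleC_scaleC)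
      with indep show False by blast
    qed
    with rel x0 have "b = c" by simp
    with \<open>a = b\<close> a show ?thesis by simp
  qed
  with c(1) that show thesis by blast
qed

theorem theorem2p7:
  fixes A T S :: "'a::complex_hilbert \<Rightarrow> 'a"
  assumes "positive_op A"
    and "T \<in> sqrt_adjointable_ops A"
    and "S \<in> sqrt_adjointable_ops A"
  shows "((\<exists>c\<in>sphere (0::complex) 1. sqrt_op A \<circ> T = (\<lambda>x. c *\<^sub>C (sqrt_op A \<circ> S) x))
        \<longleftrightarrow> (\<forall>R\<in>sqrt_adjointable_ops A.
               numerical_radius_wrt A (T \<circ> R) = numerical_radius_wrt A (S \<circ> R)))
    \<and> ((\<forall>R\<in>sqrt_adjointable_ops A.
               numerical_radius_wrt A (T \<circ> R) = numerical_radius_wrt A (S \<circ> R))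
        \<longleftrightarrow> (\<forall>x y. x \<noteq> 0 \<longrightarrow> y \<noteq> 0 \<longrightarrow>
               numerical_radius_wrt A (rank_one_wrt A (T x) y)
               = numerical_radius_wrt A (rank_one_wrt A (S x) y)))"
proof -
  let ?B = "sqrt_op A"
  let ?i = "\<exists>c\<in>sphere (0::complex) 1. ?B \<circ> T = (\<lambda>x. c *\<^sub>C (?B \<circ> S) x)"
  let ?ii = "\<forall>R\<in>sqrt_adjointable_ops A.
      numerical_radius_wrt A (T \<circ> R) = numerical_radius_wrt A (S \<circ> R)"
  let ?iii = "\<forall>x y. x \<noteq> 0 \<longrightarrow> y \<noteq> 0 \<longrightarrow>
      numerical_radius_wrt A (rank_one_wrt A (T x) y)
      = numerical_radius_wrt A (rank_one_wrt A (S x) y)"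
  note A = assms(1)
  have B: "?B \<in> bounded_ops"
    by (rule positive_opD(1)[OF positive_op_sqrt_op[OF A]])
  have T: "T \<in> bounded_ops" and S: "S \<in> bounded_ops"
    using assms(2,3) by (auto simp: sqrt_adjointable_ops_def)
  have i_ii: "?ii" if "?i"
  proof -
    from that obtain c where c: "cmod c = 1" "\<And>x. ?B (T x) = c *\<^sub>C ?B (S x)"
      by (auto simp: fun_eq_iff)
    then have "cmod (cinner_wrt A (T x) z) = cmod (cinner_wrt A (S x) z)" for x z
      by (simp add: cinner_wrt_eq_sqrt[OF A] cinner_scaleC_left norm_mult)
    then show ?thesis
      by (simp add: numerical_radius_wrt_def)
  qed
  have ii_iii: "?iii" if ii: "?ii"
  proof (intro allI impI)
    fix x y
    have "U \<circ> rank_one_wrt A x y = rank_one_wrt A (U x) y" if "U \<in> bounded_ops" for U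
      by (simp add: rank_one_wrt_def fun_eq_iff bounded_ops_scaleC[OF that])
    with ii rank_one_sqrt_adjointable[OF A, of x y] T S
    show "numerical_radius_wrt A (rank_one_wrt A (T x) y)
        = numerical_radius_wrt A (rank_one_wrt A (S x) y)"
      by metis
  qed
  have iii_i: "?i" if iii: "?iii"
  proof -
    have "\<exists>c. cmod c = 1 \<and> ?B (T x) = c *\<^sub>C ?B (S x)" for x
    proof (cases "x = 0")
      case True
      then have "?B (T x) = 1 *\<^sub>C ?B (S x)"
        by (simp add: bounded_ops_zero[OF T] bounded_ops_zero[OF S])
      then show ?thesis
        using norm_one by blast
    next
      case False
      with iii show ?thesis
        by (metis sqrt_op_unimodular_multiple_if_rank_one_radius_eq[OF A])
    qed
    then obtain c where "cmod c = 1" "\<And>x. ?B (T x) = c *\<^sub>C ?B (S x)"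
      by (rule pointwise_unimodular_multiple_imp_global[of "\<lambda>x. ?B (T x)" "\<lambda>x. ?B (S x)", rotated 4])
        (simp_all add: bounded_ops_simps[OF T] bounded_ops_simps[OF S] bounded_ops_simps[OF B])
    then show ?thesis
      by (auto simp: fun_eq_iff intro!: bexI[of _ c])
  qed
  have cycle: "(P \<longleftrightarrow> Q) \<and> (Q \<longleftrightarrow> R)" if "P \<Longrightarrow> Q" "Q \<Longrightarrow> R" "R \<Longrightarrow> P" for P Q R
    using that by blast
  show ?thesis
    by (rule cycle[OF i_ii ii_iii iii_i])
qed

end
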